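(* The metric space $(\mathcal{U},d_{\mathrm{GH}})$ is geodesic: for any compact ultrametric spaces $X,Y$ there is a curve $\gamma:[0,1]\to\mathcal{U}$ with $\gamma(0)=X$, $\gamma(1)=Y$ and $d_{\mathrm{GH}}(\gamma(s),\gamma(t))=|s-t|\,d_{\mathrm{GH}}(X,Y)$ for all $s,t\in[0,1]$.
   Context: All metric spaces are nonempty. $\mathcal{U}$ is the collection of isometry classes of compact ultrametric spaces (metric spaces with $u(x,x'')\le\max(u(x,x'),u(x',x''))$ for all points). $d_{\mathrm{GH}}$ is the usual Gromov-Hausdorff distance. *)

theory Defs
  imports "HOL-Analysis.Analysis"
begin

definition compact_ultrametric :: "'a metric \<Rightarrow> bool" where
  "compact_ultrametric X \<longleftrightarrow>
     mspace X \<noteq> {} \<and> compact_space (mtopology_of X) \<and>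
     (\<forall>x\<in>mspace X. \<forall>x'\<in>mspace X. \<forall>x''\<in>mspace X.
        mdist X x x'' \<le> max (mdist X x x') (mdist X x' x''))"

definition isometric_embedding :: "('a \<Rightarrow> 'b) \<Rightarrow> 'a metric \<Rightarrow> 'b metric \<Rightarrow> bool" where
  "isometric_embedding f X Z \<longleftrightarrow>
     f \<in> mspace X \<rightarrow> mspace Z \<and>
     (\<forall>x\<in>mspace X. \<forall>x'\<in>mspace X. mdist Z (f x) (f x') = mdist X x x')"

definition isometric :: "'a metric \<Rightarrow> 'b metric \<Rightarrow> bool" where
  "isometric X Y \<longleftrightarrow> (\<exists>f. isometric_embedding f X Y \<and> f ` mspace X = mspace Y)"

text \<open>The suprema and infima below are real-valued; this gives the Hausdorff distance
  for nonempty bounded \<open>A\<close> and \<open>B\<close>, which is the only case used.\<close>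

definition hausdorff_dist :: "'a metric \<Rightarrow> 'a set \<Rightarrow> 'a set \<Rightarrow> real" where
  "hausdorff_dist Z A B =
     max (SUP a\<in>A. INF b\<in>B. mdist Z a b) (SUP b\<in>B. INF a\<in>A. mdist Z a b)"

text \<open>The Gromov-Hausdorff distance is the infimum of the Hausdorff distances of the images of
  \<open>X\<close> and \<open>Y\<close> under isometric embeddings into a common metric space \<open>Z\<close>. Taking the points of
  \<open>Z\<close> in the type \<open>'a + 'b\<close> is no restriction: shrinking an arbitrary \<open>Z\<close> to the union of
  the two images does not change the Hausdorff distance, and this union is in bijection with a
  set of elements of \<open>'a + 'b\<close>.\<close>

definition GH_dist :: "'a metric \<Rightarrow> 'b metric \<Rightarrow> real" where
  "GH_dist X Y = Inf {hausdorff_dist Z (f ` mspace X) (g ` mspace Y) |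
       (Z :: ('a + 'b) metric) f g. isometric_embedding f X Z \<and> isometric_embedding g Y Z}"

text \<open>A compact metric space has at most continuum many points, so every isometry class of compact
  metric spaces has representatives whose points are real numbers (with a metric unrelated
  to the usual distance of the reals). The isometry class of a space over any type is
  represented by the set of all such representatives.\<close>

definition iso_class :: "'a metric \<Rightarrow> real metric set" where
  "iso_class X = {X'. isometric X X'}"

definition ultra_classes :: "real metric set set" where
  "ultra_classes = {iso_class X | X :: real metric. compact_ultrametric X}"

text \<open>The value \<open>0\<close> outside \<open>ultra_classes\<close> is there because the locale \<open>Metric_space\<close>
  constrains the distance function also outside the carrier.\<close>

definition GH_class_dist :: "real metric set \<Rightarrow> real metric set \<Rightarrow> real" where
  "GH_class_dist \<A> \<B> =
     (if \<A> \<in> ultra_classes \<and> \<B> \<in> ultra_classes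
      then the_elem {GH_dist X Y | X Y. X \<in> \<A> \<and> Y \<in> \<B>} else 0)"

definition geodesic_between ::
  "'a set \<Rightarrow> ('a \<Rightarrow> 'a \<Rightarrow> real) \<Rightarrow> 'a \<Rightarrow> 'a \<Rightarrow> (real \<Rightarrow> 'a) \<Rightarrow> bool" where
  "geodesic_between M d x y \<gamma> \<longleftrightarrow>
     \<gamma> \<in> {0..1} \<rightarrow> M \<and> \<gamma> 0 = x \<and> \<gamma> 1 = y \<and>
     (\<forall>s\<in>{0..1}. \<forall>t\<in>{0..1}. d (\<gamma> s) (\<gamma> t) = \<bar>s - t\<bar> * d x y)"

definition geodesic_metric_space :: "'a set \<Rightarrow> ('a \<Rightarrow> 'a \<Rightarrow> real) \<Rightarrow> bool" where
  "geodesic_metric_space M d \<longleftrightarrow>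
     Metric_space M d \<and> (\<forall>x\<in>M. \<forall>y\<in>M. \<exists>\<gamma>. geodesic_between M d x y \<gamma>)"


lemma isometric_embedding_compose:
  assumes "isometric_embedding h X Y" "isometric_embedding f Y Z"
  shows "isometric_embedding (f \<circ> h) X Z"
  using assms unfolding isometric_embedding_def by (auto simp: Pi_iff)

lemma isometric_refl: "isometric X X"
  unfolding isometric_def isometric_embedding_def by (intro exI[of _ id]) auto

lemma isometric_sym:
  assumes "isometric X Y"
  shows "isometric Y X"
proof -
  obtain f where f: "isometric_embedding f X Y" "f ` mspace X = mspace Y"
    using assms unfolding isometric_def by blast
  have inj: "inj_on f (mspace X)"
    by (rule inj_onI) (metis f(1) isometric_embedding_def mdist_zero)
  have "isometric_embedding (inv_into (mspace X) f) Y X"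
    using f unfolding isometric_embedding_def
    by (metis (no_types, lifting) Pi_I f_inv_into_f inv_into_into)
  moreover have "inv_into (mspace X) f ` mspace Y = mspace X"
    using f(2) inj by (metis inj_on_imp_bij_betw bij_betw_inv_into bij_betw_imp_surj_on)
  ultimately show ?thesis unfolding isometric_def by blast
qed

lemma isometric_trans:
  assumes "isometric X Y" "isometric Y Z"
  shows "isometric X Z"
  using assms unfolding isometric_def by (metis image_comp isometric_embedding_compose)

text \<open>\<open>GH_dist\<close> only depends on isometry classes, so the set in the definition of
  \<open>GH_class_dist\<close> is a singleton.\<close>

lemma GH_dist_cong:
  fixes X X' :: "'a metric" and Y Y' :: "'b metric"
  assumes "isometric X X'" "isometric Y Y'"
  shows "GH_dist X Y = GH_dist X' Y'"
proof -
  have *: "{hausdorff_dist Z (f ` mspace V) (g ` mspace W) |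
        (Z :: ('a + 'b) metric) f g. isometric_embedding f V Z \<and> isometric_embedding g W Z}
      \<subseteq> {hausdorff_dist Z (f ` mspace V') (g ` mspace W') |
        (Z :: ('a + 'b) metric) f g. isometric_embedding f V' Z \<and> isometric_embedding g W' Z}"
    if iso: "isometric V' V" "isometric W' W" for V V' :: "'a metric" and W W' :: "'b metric"
  proof clarify
    fix Z :: "('a + 'b) metric" and f g
    assume fg: "isometric_embedding f V Z" "isometric_embedding g W Z"
    obtain h k where hk: "isometric_embedding h V' V" "h ` mspace V' = mspace V"
      "isometric_embedding k W' W" "k ` mspace W' = mspace W"
      using iso unfolding isometric_def by blast
    have "isometric_embedding (f \<circ> h) V' Z" "isometric_embedding (g \<circ> k) W' Z"
      using fg hk isometric_embedding_compose by blast+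
    moreover have "f ` mspace V = (f \<circ> h) ` mspace V'" "g ` mspace W = (g \<circ> k) ` mspace W'"
      using hk by (metis image_comp)+
    ultimately show "\<exists>Z' f' g'. hausdorff_dist Z (f ` mspace V) (g ` mspace W)
        = hausdorff_dist Z' (f' ` mspace V') (g' ` mspace W')
        \<and> isometric_embedding f' V' (Z' :: ('a + 'b) metric) \<and> isometric_embedding g' W' Z'"
      by metis
  qed
  show ?thesis
    unfolding GH_dist_def using *[of X' X Y' Y] *[of X X' Y Y'] assms isometric_sym
    by (metis (no_types, lifting) subset_antisym)
qed

lemma GH_class_dist_iso_class:
  fixes X Y :: "real metric"
  assumes "compact_ultrametric X" "compact_ultrametric Y"
  shows "GH_class_dist (iso_class X) (iso_class Y) = GH_dist X Y"
proof -
  have "{GH_dist X' Y' | X' Y'. X' \<in> iso_class X \<and> Y' \<in> iso_class Y} = {GH_dist X Y}"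
  proof (intro equalityI subsetI)
    fix r assume "r \<in> {GH_dist X' Y' | X' Y'. X' \<in> iso_class X \<and> Y' \<in> iso_class Y}"
    then show "r \<in> {GH_dist X Y}"
      unfolding iso_class_def using GH_dist_cong[of X _ Y _] by auto
  next
    fix r assume "r \<in> {GH_dist X Y}"
    then show "r \<in> {GH_dist X' Y' | X' Y'. X' \<in> iso_class X \<and> Y' \<in> iso_class Y}"
      unfolding iso_class_def using isometric_refl by blast
  qed
  then show ?thesis
    using assms unfolding GH_class_dist_def ultra_classes_def by auto
qed

end

theory Submission
  imports Defs
begin

text \<open>For compact spaces, \<open>2 * GH_dist X Y\<close> is the least distortion \<open>c\<close> of a correspondence \<open>R\<close>, and
  by compactness it is attained by a closed \<open>R\<close>. On such an \<open>R\<close> the function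
  \<open>max 0 (max (d\<^sub>X - t * c) (d\<^sub>Y - (1 - t) * c))\<close> is a pseudo-ultrametric for each \<open>t \<in> {0..1}\<close>. It equals
  \<open>d\<^sub>X\<close> at \<open>t = 0\<close> and \<open>d\<^sub>Y\<close> at \<open>t = 1\<close> because \<open>\<bar>d\<^sub>X - d\<^sub>Y\<bar> \<le> c\<close> on \<open>R\<close>, and it is \<open>c\<close>-Lipschitz in
  \<open>t\<close>, so its metric quotients form a curve from \<open>X\<close> to \<open>Y\<close> whose pieces have Gromov-Hausdorff distance
  at most \<open>\<bar>s - t\<bar> * GH_dist X Y\<close>. Equality follows from the triangle inequality.\<close>

subsection \<open>Correspondences\<close>

lemma mdist_self [simp]: "x \<in> mspace X \<Longrightarrow> mdist X x x = 0"
  by simp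

text \<open>A correspondence of distortion at most \<open>c\<close>. Bounding the distortion,
  instead of naming its supremum, avoids boundedness conditions for real suprema.\<close>

definition bounded_correspondence ::
  "real \<Rightarrow> 'a metric \<Rightarrow> 'b metric \<Rightarrow> ('a \<times> 'b) set \<Rightarrow> bool" where
  "bounded_correspondence c X Y R \<longleftrightarrow>
     fst ` R = mspace X \<and> snd ` R = mspace Y \<and>
     (\<forall>p\<in>R. \<forall>q\<in>R. \<bar>mdist X (fst p) (fst q) - mdist Y (snd p) (snd q)\<bar> \<le> c)"

lemma bounded_correspondenceD:
  assumes "bounded_correspondence c X Y R"
  shows "p \<in> R \<Longrightarrow> fst p \<in> mspace X" "p \<in> R \<Longrightarrow> snd p \<in> mspace Y"
    "x \<in> mspace X \<Longrightarrow> \<exists>p\<in>R. fst p = x" "y \<in> mspace Y \<Longrightarrow> \<exists>p\<in>R. snd p = y"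
    "p \<in> R \<Longrightarrow> q \<in> R \<Longrightarrow> \<bar>mdist X (fst p) (fst q) - mdist Y (snd p) (snd q)\<bar> \<le> c"
proof -
  have *: "fst ` R = mspace X" "snd ` R = mspace Y"
    and d: "\<forall>p\<in>R. \<forall>q\<in>R. \<bar>mdist X (fst p) (fst q) - mdist Y (snd p) (snd q)\<bar> \<le> c"
    using assms unfolding bounded_correspondence_def by auto
  show "p \<in> R \<Longrightarrow> fst p \<in> mspace X" "p \<in> R \<Longrightarrow> snd p \<in> mspace Y"
    "x \<in> mspace X \<Longrightarrow> \<exists>p\<in>R. fst p = x" "y \<in> mspace Y \<Longrightarrow> \<exists>p\<in>R. snd p = y"
    unfolding *[symmetric] by auto
  show "p \<in> R \<Longrightarrow> q \<in> R \<Longrightarrow> \<bar>mdist X (fst p) (fst q) - mdist Y (snd p) (snd q)\<bar> \<le> c"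
    using d by simp
qed

lemma bounded_correspondenceI:
  assumes "\<And>p. p \<in> R \<Longrightarrow> fst p \<in> mspace X \<and> snd p \<in> mspace Y"
    and "\<And>x. x \<in> mspace X \<Longrightarrow> \<exists>p\<in>R. fst p = x"
    and "\<And>y. y \<in> mspace Y \<Longrightarrow> \<exists>p\<in>R. snd p = y"
    and "\<And>p q. p \<in> R \<Longrightarrow> q \<in> R \<Longrightarrow> \<bar>mdist X (fst p) (fst q) - mdist Y (snd p) (snd q)\<bar> \<le> c"
  shows "bounded_correspondence c X Y R"
  unfolding bounded_correspondence_def using assms by (auto simp: image_iff; metis fst_conv snd_conv)

lemma bounded_correspondence_mono:
  "bounded_correspondence c X Y R \<Longrightarrow> c \<le> c' \<Longrightarrow> bounded_correspondence c' X Y R"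
  unfolding bounded_correspondence_def by fastforce

lemma bounded_correspondence_nonneg:
  assumes "bounded_correspondence c X Y R" "mspace X \<noteq> {}"
  shows "0 \<le> c"
proof -
  obtain p where "p \<in> R" using assms unfolding bounded_correspondence_def by blast
  then show ?thesis using bounded_correspondenceD(5)[OF assms(1), of p p] by linarith
qed

lemma bounded_correspondence_converse:
  assumes "bounded_correspondence c X Y R"
  shows "bounded_correspondence c Y X (R\<inverse>)"
proof (rule bounded_correspondenceI)
  fix p q assume "p \<in> R\<inverse>" "q \<in> R\<inverse>"
  then show "\<bar>mdist Y (fst p) (fst q) - mdist X (snd p) (snd q)\<bar> \<le> c"
    using bounded_correspondenceD(5)[OF assms, of "prod.swap p" "prod.swap q"] by auto
next
  fix p assume "p \<in> R\<inverse>"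
  then show "fst p \<in> mspace Y \<and> snd p \<in> mspace X"
    using bounded_correspondenceD(1,2)[OF assms, of "prod.swap p"] by auto
qed (use bounded_correspondenceD(3,4)[OF assms] in force)+

text \<open>Distortions add because composed pairs share their middle points. This becomes the
  triangle inequality for \<open>GH_dist\<close>.\<close>

lemma bounded_correspondence_relcomp:
  assumes R: "bounded_correspondence c X Y R" and S: "bounded_correspondence c' Y Z S"
  shows "bounded_correspondence (c + c') X Z (R O S)"
proof (rule bounded_correspondenceI)
  fix p assume "p \<in> R O S"
  then show "fst p \<in> mspace X \<and> snd p \<in> mspace Z"
    using bounded_correspondenceD(1)[OF R] bounded_correspondenceD(2)[OF S] by force
next
  fix x assume "x \<in> mspace X"
  then obtain p where p: "p \<in> R" "fst p = x" using bounded_correspondenceD(3)[OF R] by blast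
  then obtain q where "q \<in> S" "fst q = snd p"
    using bounded_correspondenceD(2)[OF R] bounded_correspondenceD(3)[OF S] by meson
  with p have "(x, snd p) \<in> R" "(snd p, snd q) \<in> S" by (metis prod.collapse)+
  then show "\<exists>p\<in>R O S. fst p = x" by (metis fst_conv relcomp.relcompI)
next
  fix z assume "z \<in> mspace Z"
  then obtain q where q: "q \<in> S" "snd q = z" using bounded_correspondenceD(4)[OF S] by blast
  then obtain p where "p \<in> R" "snd p = fst q"
    using bounded_correspondenceD(1)[OF S] bounded_correspondenceD(4)[OF R] by meson
  with q have "(fst p, fst q) \<in> R" "(fst q, z) \<in> S" by (metis prod.collapse)+
  then show "\<exists>p\<in>R O S. snd p = z" by (metis snd_conv relcomp.relcompI)
next
  fix p q assume "p \<in> R O S" "q \<in> R O S"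
  then obtain y y' where "(fst p, y) \<in> R" "(y, snd p) \<in> S" "(fst q, y') \<in> R" "(y', snd q) \<in> S"
    by auto
  then show "\<bar>mdist X (fst p) (fst q) - mdist Z (snd p) (snd q)\<bar> \<le> c + c'"
    using bounded_correspondenceD(5)[OF R, of "(fst p, y)" "(fst q, y')"]
      bounded_correspondenceD(5)[OF S, of "(y, snd p)" "(y', snd q)"] by auto
qed

lemma isometric_imp_bounded_correspondence:
  assumes "isometric X Y"
  shows "\<exists>R. bounded_correspondence 0 X Y R"
proof -
  obtain f where f: "isometric_embedding f X Y" "f ` mspace X = mspace Y"
    using assms unfolding isometric_def by blast
  then have "bounded_correspondence 0 X Y ((\<lambda>x. (x, f x)) ` mspace X)"
    unfolding bounded_correspondence_def isometric_embedding_def by (auto simp: image_image)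
  then show ?thesis ..
qed

text \<open>With distortion \<open>0\<close>, two partners of the same point are at distance
  \<open>0\<close>, so \<open>R\<close> is the graph of a function \<open>f\<close>. Since
  \<open>R\<close> projects onto \<open>Y\<close>, \<open>f\<close> is surjective.\<close>

lemma bounded_correspondence_0_imp_isometric:
  assumes "bounded_correspondence 0 X Y R"
  shows "isometric X Y"
proof -
  note D = bounded_correspondenceD[OF assms]
  have "\<forall>x\<in>mspace X. \<exists>y. (x, y) \<in> R" using D(3) by force
  then obtain f where f: "\<And>x. x \<in> mspace X \<Longrightarrow> (x, f x) \<in> R" by metis
  have fim: "f x \<in> mspace Y" if "x \<in> mspace X" for x using D(2)[OF f[OF that]] by simp
  have "mdist Y (f x) (f x') = mdist X x x'" if "x \<in> mspace X" "x' \<in> mspace X" for x x'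
    using D(5)[OF f[OF that(1)] f[OF that(2)]] by simp
  then have "isometric_embedding f X Y" using fim unfolding isometric_embedding_def by auto
  moreover have "y \<in> f ` mspace X" if y: "y \<in> mspace Y" for y
  proof -
    obtain x where x: "(x, y) \<in> R" using D(4)[OF y] by force
    have xX: "x \<in> mspace X" using D(1)[OF x] by simp
    have "mdist Y (f x) y = 0" using D(5)[OF f[OF xX] x] xX mdist_nonneg[of Y "f x" y] by simp
    then have "f x = y" using fim xX y by simp
    then show ?thesis using xX by blast
  qed
  ultimately show ?thesis unfolding isometric_def using fim by blast
qed

subsection \<open>The Gromov-Hausdorff distance of compact spaces\<close>

text \<open>The metric on the disjoint union for which points matched by \<open>R\<close> are at distance \<open>r\<close>; this needs
  that the distortion of \<open>R\<close> is at most \<open>2 * r\<close>.\<close>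

definition glue_dist ::
  "'a metric \<Rightarrow> 'b metric \<Rightarrow> ('a \<times> 'b) set \<Rightarrow> real \<Rightarrow> 'a \<Rightarrow> 'b \<Rightarrow> real" where
  "glue_dist X Y R r x y = (INF p\<in>R. mdist X x (fst p) + r + mdist Y (snd p) y)"

fun glue_mdist ::
  "'a metric \<Rightarrow> 'b metric \<Rightarrow> ('a \<times> 'b) set \<Rightarrow> real \<Rightarrow> 'a + 'b \<Rightarrow> 'a + 'b \<Rightarrow> real" where
  "glue_mdist X Y R r (Inl x) (Inl x') = mdist X x x'"
| "glue_mdist X Y R r (Inr y) (Inr y') = mdist Y y y'"
| "glue_mdist X Y R r (Inl x) (Inr y) = glue_dist X Y R r x y"
| "glue_mdist X Y R r (Inr y) (Inl x) = glue_dist X Y R r x y"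

lemma glue_dist_le:
  assumes "0 \<le> r" "p \<in> R"
  shows "glue_dist X Y R r x y \<le> mdist X x (fst p) + r + mdist Y (snd p) y"
  unfolding glue_dist_def
  by (rule cINF_lower) (use assms in \<open>auto intro!: bdd_belowI[of _ 0]\<close>)

lemma glue_dist_greatest:
  assumes "R \<noteq> {}" "\<And>p. p \<in> R \<Longrightarrow> c \<le> mdist X x (fst p) + r + mdist Y (snd p) y"
  shows "c \<le> glue_dist X Y R r x y"
  unfolding glue_dist_def by (rule cINF_greatest) (use assms in auto)

text \<open>Positive \<open>r\<close> keeps the two copies apart. The distortion bound enters only
  for triangles that leave a copy and come back: the two crossings cost \<open>2 * r\<close>, which
  pays for the distortion of \<open>R\<close>.\<close>

lemma Metric_space_glue:
  assumes R: "bounded_correspondence (2 * r) X Y R" and r: "0 < r" and ne: "mspace X \<noteq> {}"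
  shows "Metric_space (mspace X <+> mspace Y) (glue_mdist X Y R r)"
proof -
  note D = bounded_correspondenceD[OF R]
  have Rne: "R \<noteq> {}" using R ne unfolding bounded_correspondence_def by blast
  let ?g = "glue_dist X Y R r"
  note le = glue_dist_le[OF less_imp_le[OF r], of _ R X Y]
    and ge = glue_dist_greatest[OF Rne, of _ X _ r Y]
  have pos: "r \<le> ?g x y" for x y by (rule ge) auto
  have left: "?g x y \<le> mdist X x x' + ?g x' y" if "x \<in> mspace X" "x' \<in> mspace X" for x x' y
  proof -
    have "?g x y - mdist X x x' \<le> ?g x' y"
    proof (rule ge)
      fix p assume p: "p \<in> R"
      show "?g x y - mdist X x x' \<le> mdist X x' (fst p) + r + mdist Y (snd p) y"
        using le[OF p, of x y] mdist_triangle[OF that D(1)[OF p]] by linarith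
    qed
    then show ?thesis by simp
  qed
  have right: "?g x y \<le> ?g x y' + mdist Y y' y" if "y \<in> mspace Y" "y' \<in> mspace Y" for x y y'
  proof -
    have "?g x y - mdist Y y' y \<le> ?g x y'"
    proof (rule ge)
      fix p assume p: "p \<in> R"
      show "?g x y - mdist Y y' y \<le> mdist X x (fst p) + r + mdist Y (snd p) y'"
        using le[OF p, of x y] mdist_triangle[OF D(2)[OF p] that(2,1)] by linarith
    qed
    then show ?thesis by simp
  qed
  \<comment> \<open>The path crosses along \<open>p\<close> and returns along \<open>q\<close>; the
    leg from \<open>fst p\<close> to \<open>fst q\<close> is traded for the one from
    \<open>snd p\<close> to \<open>snd q\<close>. The two infima are handled one at a time, the
    other term being moved to the left side.\<close>
  have across: "mdist X x x' \<le> ?g x y + ?g x' y"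
    if xy: "x \<in> mspace X" "x' \<in> mspace X" "y \<in> mspace Y" for x x' y
  proof -
    have "mdist X x x' - ?g x' y \<le> ?g x y"
    proof (rule ge)
      fix p assume p: "p \<in> R"
      have "mdist X x x' - (mdist X x (fst p) + r + mdist Y (snd p) y) \<le> ?g x' y"
      proof (rule ge)
        fix q assume q: "q \<in> R"
        have "mdist X x x' \<le> mdist X x (fst p) + mdist X (fst p) (fst q) + mdist X (fst q) x'"
          using mdist_triangle[OF xy(1) D(1)[OF p] xy(2)]
            mdist_triangle[OF D(1)[OF p] D(1)[OF q] xy(2)] by linarith
        moreover have "mdist Y (snd p) (snd q) \<le> mdist Y (snd p) y + mdist Y (snd q) y"
          using mdist_triangle[OF D(2)[OF p] xy(3) D(2)[OF q]] mdist_commute[of Y] by metis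
        ultimately show "mdist X x x' - (mdist X x (fst p) + r + mdist Y (snd p) y)
            \<le> mdist X x' (fst q) + r + mdist Y (snd q) y"
          using D(5)[OF p q] mdist_commute[of X "fst q" x'] by linarith
      qed
      then show "mdist X x x' - ?g x' y \<le> mdist X x (fst p) + r + mdist Y (snd p) y" by linarith
    qed
    then show "mdist X x x' \<le> ?g x y + ?g x' y" by linarith
  qed
  have across': "mdist Y y y' \<le> ?g x y + ?g x y'"
    if xy: "x \<in> mspace X" "y \<in> mspace Y" "y' \<in> mspace Y" for x y y'
  proof -
    have "mdist Y y y' - ?g x y' \<le> ?g x y"
    proof (rule ge)
      fix p assume p: "p \<in> R"
      have "mdist Y y y' - (mdist X x (fst p) + r + mdist Y (snd p) y) \<le> ?g x y'"
      proof (rule ge)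
        fix q assume q: "q \<in> R"
        have "mdist Y y y' \<le> mdist Y y (snd p) + mdist Y (snd p) (snd q) + mdist Y (snd q) y'"
          using mdist_triangle[OF xy(2) D(2)[OF p] xy(3)]
            mdist_triangle[OF D(2)[OF p] D(2)[OF q] xy(3)] by linarith
        moreover have "mdist X (fst p) (fst q) \<le> mdist X x (fst p) + mdist X x (fst q)"
          using mdist_triangle[OF D(1)[OF p] xy(1) D(1)[OF q]] mdist_commute[of X] by metis
        ultimately show "mdist Y y y' - (mdist X x (fst p) + r + mdist Y (snd p) y)
            \<le> mdist X x (fst q) + r + mdist Y (snd q) y'"
          using D(5)[OF p q] mdist_commute[of Y y "snd p"] by linarith
      qed
      then show "mdist Y y y' - ?g x y' \<le> mdist X x (fst p) + r + mdist Y (snd p) y" by linarith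
    qed
    then show "mdist Y y y' \<le> ?g x y + ?g x y'" by linarith
  qed
  \<comment> \<open>Mirrored forms of \<open>left\<close> and \<open>right\<close>, as they arise in
    the case split when the path starts in the copy of \<open>Y\<close> and ends in that of
    \<open>X\<close>.\<close>
  have left': "?g x y \<le> ?g x' y + mdist X x' x" if "x \<in> mspace X" "x' \<in> mspace X" for x x' y
    using left[OF that] mdist_commute[of X x x'] by (simp add: add.commute)
  have right': "?g x y \<le> mdist Y y y' + ?g x y'" if "y \<in> mspace Y" "y' \<in> mspace Y" for x y y'
    using right[OF that] mdist_commute[of Y y y'] by (simp add: add.commute)
  let ?d = "glue_mdist X Y R r"
  show ?thesis
  proof
    fix u v
    show "0 \<le> ?d u v"
      using pos r by (cases u; cases v) (auto intro: order_trans[OF less_imp_le])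
    show "?d u v = ?d v u"
      by (cases u; cases v) (auto simp: mdist_commute)
    show "?d u v = 0 \<longleftrightarrow> u = v" if "u \<in> mspace X <+> mspace Y" "v \<in> mspace X <+> mspace Y"
    proof -
      have "?g x y \<noteq> 0" for x y using pos[of x y] r by linarith
      then show ?thesis using that by (cases u; cases v) auto
    qed
  next
    fix u v w
    assume "u \<in> mspace X <+> mspace Y" "v \<in> mspace X <+> mspace Y" "w \<in> mspace X <+> mspace Y"
    then show "?d u w \<le> ?d u v + ?d v w"
      by (cases u; cases v; cases w)
        (auto simp: mdist_triangle left left' right right' across across')
  qed
qed

section \<open>Hausdorff distances of bounded sets and the link to correspondences\<close>

text \<open>The bound \<open>K\<close> makes the real suprema in \<open>hausdorff_dist\<close>
  genuine upper bounds. The inequality with \<open>h\<close> is strict because an infimum need not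
  be attained.\<close>

lemma hausdorff_dist_bounds:
  assumes "A \<noteq> {}" "B \<noteq> {}" and K: "\<And>a b. a \<in> A \<Longrightarrow> b \<in> B \<Longrightarrow> mdist Z a b \<le> K"
  shows "0 \<le> hausdorff_dist Z A B"
    and "a \<in> A \<Longrightarrow> hausdorff_dist Z A B < h \<Longrightarrow> \<exists>b\<in>B. mdist Z a b < h"
    and "b \<in> B \<Longrightarrow> hausdorff_dist Z A B < h \<Longrightarrow> \<exists>a\<in>A. mdist Z a b < h"
proof -
  have bdd: "bdd_below ((\<lambda>b. mdist Z a b) ` B)" "bdd_below ((\<lambda>a. mdist Z a b) ` A)" for a b
    by (auto intro!: bdd_belowI[of _ 0])
  obtain a0 b0 where 0: "a0 \<in> A" "b0 \<in> B" using assms by blast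
  have up: "bdd_above ((\<lambda>a. INF b\<in>B. mdist Z a b) ` A)" "bdd_above ((\<lambda>b. INF a\<in>A. mdist Z a b) ` B)"
    using 0 K by (auto intro!: bdd_aboveI[of _ K] cINF_lower2[OF bdd(1)] cINF_lower2[OF bdd(2)])
  have L: "(INF b\<in>B. mdist Z a b) \<le> hausdorff_dist Z A B" if "a \<in> A" for a
    unfolding hausdorff_dist_def using cSUP_upper[OF that up(1)] by simp
  have M: "(INF a\<in>A. mdist Z a b) \<le> hausdorff_dist Z A B" if "b \<in> B" for b
    unfolding hausdorff_dist_def using cSUP_upper[OF that up(2)] by simp
  have "0 \<le> (INF b\<in>B. mdist Z a0 b)" using assms by (intro cINF_greatest) auto
  then show "0 \<le> hausdorff_dist Z A B" using L[OF 0(1)] by simp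
  show "\<exists>b\<in>B. mdist Z a b < h" if "a \<in> A" "hausdorff_dist Z A B < h"
    using le_less_trans[OF L[OF that(1)] that(2)] by (simp add: cINF_less_iff[OF assms(2) bdd(1)])
  show "\<exists>a\<in>A. mdist Z a b < h" if "b \<in> B" "hausdorff_dist Z A B < h"
    using le_less_trans[OF M[OF that(1)] that(2)] by (simp add: cINF_less_iff[OF assms(1) bdd(2)])
qed

lemma hausdorff_dist_le:
  assumes "A \<noteq> {}" "B \<noteq> {}" "\<And>a. a \<in> A \<Longrightarrow> \<exists>b\<in>B. mdist Z a b \<le> h"
    and "\<And>b. b \<in> B \<Longrightarrow> \<exists>a\<in>A. mdist Z a b \<le> h"
  shows "hausdorff_dist Z A B \<le> h"
proof -
  have "(INF b\<in>B. mdist Z a b) \<le> h" if "a \<in> A" for a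
    using assms(3)[OF that] by (auto intro!: cINF_lower2 bdd_belowI[of _ 0])
  moreover have "(INF a\<in>A. mdist Z a b) \<le> h" if "b \<in> B" for b
    using assms(4)[OF that] by (auto intro!: cINF_lower2 bdd_belowI[of _ 0])
  ultimately show ?thesis
    unfolding hausdorff_dist_def using assms(1,2) by (auto intro!: cSUP_least)
qed

lemma compact_mdist_bounded:
  assumes "compact_space (mtopology_of X)"
  obtains K where "\<And>x y. x \<in> mspace X \<Longrightarrow> y \<in> mspace X \<Longrightarrow> mdist X x y \<le> K"
proof -
  interpret Metric_space "mspace X" "mdist X" by (rule Metric_space_mspace_mdist)
  have "mbounded (mspace X)"
    using assms compactin_imp_mbounded unfolding compact_space_def mtopology_of_def by simp
  then show ?thesis using that unfolding mbounded_alt by blast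
qed

text \<open>Compact spaces have finite diameter, and a detour through base points \<open>x0\<close>
  and \<open>y0\<close> bounds the distances between the images. This supplies the \<open>K\<close>
  of \<open>hausdorff_dist_bounds\<close>.\<close>

lemma embedding_images_bounded:
  assumes "compact_space (mtopology_of X)" "compact_space (mtopology_of Y)"
    and f: "isometric_embedding f X Z" and g: "isometric_embedding g Y Z"
  obtains K where "\<And>a b. a \<in> f ` mspace X \<Longrightarrow> b \<in> g ` mspace Y \<Longrightarrow> mdist Z a b \<le> K"
proof (cases "mspace X = {} \<or> mspace Y = {}")
  case True
  then show ?thesis using that by blast
next
  case False
  then obtain x0 y0 where 0: "x0 \<in> mspace X" "y0 \<in> mspace Y" by blast
  obtain K L where K: "\<And>x y. x \<in> mspace X \<Longrightarrow> y \<in> mspace X \<Longrightarrow> mdist X x y \<le> K"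
    and L: "\<And>x y. x \<in> mspace Y \<Longrightarrow> y \<in> mspace Y \<Longrightarrow> mdist Y x y \<le> L"
    using compact_mdist_bounded assms(1,2) by metis
  have "mdist Z (f x) (g y) \<le> K + mdist Z (f x0) (g y0) + L"
    if xy: "x \<in> mspace X" "y \<in> mspace Y" for x y
  proof -
    have im: "f x \<in> mspace Z" "f x0 \<in> mspace Z" "g y \<in> mspace Z" "g y0 \<in> mspace Z"
      using f g xy 0 unfolding isometric_embedding_def by auto
    have "mdist Z (f x) (f x0) \<le> K" "mdist Z (g y0) (g y) \<le> L"
      using f g xy 0 K L unfolding isometric_embedding_def by auto
    then show ?thesis
      using mdist_triangle[OF im(1,2,3)] mdist_triangle[OF im(2,4,3)] by linarith
  qed
  then show ?thesis using that by blast
qed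

text \<open>Gluing \<open>X\<close> and \<open>Y\<close> along \<open>R\<close> puts matched points
  within the matching distance of each other. That distance must be positive while \<open>r\<close>
  may be \<open>0\<close>, hence the detour through \<open>r + e\<close>.\<close>

lemma GH_dist_le:
  fixes X :: "'a metric" and Y :: "'b metric"
  assumes cpt: "compact_space (mtopology_of X)" "compact_space (mtopology_of Y)"
    and ne: "mspace X \<noteq> {}" and R: "bounded_correspondence (2 * r) X Y R"
  shows "GH_dist X Y \<le> r"
proof (rule field_le_epsilon)
  fix e :: real assume e: "0 < e"
  have r0: "0 \<le> r" using bounded_correspondence_nonneg[OF R ne] by simp
  define s where "s = r + e"
  have s: "0 < s" using r0 e s_def by simp
  have R': "bounded_correspondence (2 * s) X Y R"
    by (rule bounded_correspondence_mono[OF R]) (use e s_def in simp)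
  note D = bounded_correspondenceD[OF R]
  have ne': "mspace Y \<noteq> {}" using ne R unfolding bounded_correspondence_def by blast
  interpret Metric_space "mspace X <+> mspace Y" "glue_mdist X Y R s"
    by (rule Metric_space_glue[OF R' s ne])
  define Z where "Z = metric (mspace X <+> mspace Y, glue_mdist X Y R s)"
  have Z: "mspace Z = mspace X <+> mspace Y" "mdist Z = glue_mdist X Y R s"
    unfolding Z_def by auto
  have emb: "isometric_embedding Inl X Z" "isometric_embedding Inr Y Z"
    unfolding isometric_embedding_def Z by auto
  have match: "mdist Z (Inl (fst p)) (Inr (snd p)) \<le> s" if "p \<in> R" for p
    unfolding Z using glue_dist_le[OF less_imp_le[OF s] that, of X Y "fst p" "snd p"] D(1,2)[OF that]
    by simp
  have "hausdorff_dist Z (Inl ` mspace X) (Inr ` mspace Y) \<le> s"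
  proof (rule hausdorff_dist_le)
    fix a :: "'a + 'b" assume "a \<in> Inl ` mspace X"
    then obtain p where "p \<in> R" "a = Inl (fst p)" using D(3) by (metis imageE)
    then show "\<exists>b\<in>Inr ` mspace Y. mdist Z a b \<le> s" using match D(2) by blast
  next
    fix b :: "'a + 'b" assume "b \<in> Inr ` mspace Y"
    then obtain p where "p \<in> R" "b = Inr (snd p)" using D(4) by (metis imageE)
    then show "\<exists>a\<in>Inl ` mspace X. mdist Z a b \<le> s" using match D(1) by blast
  qed (use ne ne' in auto)
  \<comment> \<open>A real \<open>Inf\<close> is a lower bound only of a set that is bounded below;
    compactness of \<open>X\<close> and \<open>Y\<close> is used for this.\<close>
  moreover have "bdd_below {hausdorff_dist Z (f ` mspace X) (g ` mspace Y) |
       (Z :: ('a + 'b) metric) f g. isometric_embedding f X Z \<and> isometric_embedding g Y Z}"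
  proof (rule bdd_belowI[of _ 0], clarify)
    fix Z :: "('a + 'b) metric" and f g
    assume fg: "isometric_embedding f X Z" "isometric_embedding g Y Z"
    obtain K where "\<And>a b. a \<in> f ` mspace X \<Longrightarrow> b \<in> g ` mspace Y \<Longrightarrow> mdist Z a b \<le> K"
      using embedding_images_bounded[OF cpt fg] by blast
    then show "0 \<le> hausdorff_dist Z (f ` mspace X) (g ` mspace Y)"
      using ne ne' by (intro hausdorff_dist_bounds(1)) auto
  qed
  ultimately show "GH_dist X Y \<le> r + e"
    unfolding GH_dist_def s_def[symmetric] using emb by (intro cInf_lower2) auto
qed

text \<open>In a joint embedding with Hausdorff distance below \<open>r\<close>, the pairs of points
  closer than \<open>r\<close> form the correspondence; the triangle inequality through both matches
  bounds its distortion.\<close>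

lemma GH_dist_less_imp_correspondence:
  fixes X :: "'a metric" and Y :: "'b metric"
  assumes cpt: "compact_space (mtopology_of X)" "compact_space (mtopology_of Y)"
    and ne: "mspace X \<noteq> {}" "mspace Y \<noteq> {}" and less: "GH_dist X Y < r"
  shows "\<exists>R. bounded_correspondence (2 * r) X Y R"
proof -
  let ?H = "{hausdorff_dist Z (f ` mspace X) (g ` mspace Y) |
       (Z :: ('a + 'b) metric) f g. isometric_embedding f X Z \<and> isometric_embedding g Y Z}"
  \<comment> \<open>A small real infimum yields an element only of a nonempty set. The element
    exhibited is the gluing along the full product, whose distortion is at most the larger of the
    diameter bounds \<open>K\<close> and \<open>L\<close>; the \<open>1\<close> in \<open>s\<close>
    makes the matching distance positive.\<close>
  have "?H \<noteq> {}"
  proof -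
    obtain K where K: "\<And>x y. x \<in> mspace X \<Longrightarrow> y \<in> mspace X \<Longrightarrow> mdist X x y \<le> K"
      using compact_mdist_bounded cpt(1) by metis
    obtain L where L: "\<And>x y. x \<in> mspace Y \<Longrightarrow> y \<in> mspace Y \<Longrightarrow> mdist Y x y \<le> L"
      using compact_mdist_bounded cpt(2) by metis
    define s where "s = max 1 (max K L)"
    have "\<bar>mdist X x x' - mdist Y y y'\<bar> \<le> 2 * s"
      if "x \<in> mspace X" "x' \<in> mspace X" "y \<in> mspace Y" "y' \<in> mspace Y" for x x' y y'
      using K[OF that(1,2)] L[OF that(3,4)] mdist_nonneg[of X x x'] mdist_nonneg[of Y y y']
      unfolding s_def by (smt (verit))
    then have R: "bounded_correspondence (2 * s) X Y (mspace X \<times> mspace Y)"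
      using ne by (intro bounded_correspondenceI) auto
    have s: "0 < s" unfolding s_def by simp
    interpret Metric_space "mspace X <+> mspace Y" "glue_mdist X Y (mspace X \<times> mspace Y) s"
      by (rule Metric_space_glue[OF R s ne(1)])
    define Z where "Z = metric (mspace X <+> mspace Y, glue_mdist X Y (mspace X \<times> mspace Y) s)"
    have Z: "mspace Z = mspace X <+> mspace Y" "mdist Z = glue_mdist X Y (mspace X \<times> mspace Y) s"
      unfolding Z_def by auto
    have "isometric_embedding Inl X Z" "isometric_embedding Inr Y Z"
      unfolding isometric_embedding_def Z by auto
    then show ?thesis by blast
  qed
  then obtain Z :: "('a + 'b) metric" and f g
    where f: "isometric_embedding f X Z" and g: "isometric_embedding g Y Z"
      and h: "hausdorff_dist Z (f ` mspace X) (g ` mspace Y) < r"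
    using cInf_lessD[of ?H r] less unfolding GH_dist_def by blast
  obtain K where K: "\<And>a b. a \<in> f ` mspace X \<Longrightarrow> b \<in> g ` mspace Y \<Longrightarrow> mdist Z a b \<le> K"
    using embedding_images_bounded[OF cpt f g] by blast
  have im: "x \<in> mspace X \<Longrightarrow> f x \<in> mspace Z" "y \<in> mspace Y \<Longrightarrow> g y \<in> mspace Z" for x y
    using f g unfolding isometric_embedding_def by auto
  let ?R = "{(x, y). x \<in> mspace X \<and> y \<in> mspace Y \<and> mdist Z (f x) (g y) < r}"
  have "bounded_correspondence (2 * r) X Y ?R"
  proof (rule bounded_correspondenceI)
    fix x assume "x \<in> mspace X"
    then show "\<exists>p\<in>?R. fst p = x"
      using hausdorff_dist_bounds(2)[OF _ _ K _ h, of "f x"] ne by fastforce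
  next
    fix y assume "y \<in> mspace Y"
    then show "\<exists>p\<in>?R. snd p = y"
      using hausdorff_dist_bounds(3)[OF _ _ K _ h, of "g y"] ne by fastforce
  next
    fix p q assume "p \<in> ?R" "q \<in> ?R"
    then obtain x y x' y' where pq: "p = (x, y)" "q = (x', y')"
      and m: "x \<in> mspace X" "y \<in> mspace Y" "x' \<in> mspace X" "y' \<in> mspace Y"
      and l: "mdist Z (f x) (g y) < r" "mdist Z (f x') (g y') < r" by auto
    note i = im(1)[OF m(1)] im(2)[OF m(2)] im(1)[OF m(3)] im(2)[OF m(4)]
    have "mdist Z (f x) (f x') = mdist X x x'" "mdist Z (g y) (g y') = mdist Y y y'"
      using f g m unfolding isometric_embedding_def by auto
    moreover have "mdist Z (f x) (f x') \<le> mdist Z (f x) (g y) + mdist Z (g y) (g y') + mdist Z (f x') (g y')"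
      using mdist_triangle[OF i(1,2,3)] mdist_triangle[OF i(2,4,3)] mdist_commute[of Z "g y'" "f x'"]
      by linarith
    moreover have "mdist Z (g y) (g y') \<le> mdist Z (f x) (g y) + mdist Z (f x) (f x') + mdist Z (f x') (g y')"
      using mdist_triangle[OF i(2,1,4)] mdist_triangle[OF i(1,3,4)] mdist_commute[of Z "g y" "f x"]
      by linarith
    ultimately show "\<bar>mdist X (fst p) (fst q) - mdist Y (snd p) (snd q)\<bar> \<le> 2 * r"
      using l pq by auto
  qed auto
  then show ?thesis ..
qed

text \<open>A correspondence is a point of the product of the compact sets of pairs over each point of \<open>X\<close> and
  of \<open>Y\<close>, and the distortion bound \<open>c'\<close> is a closed condition, so Tychonoff gives the limiting case.\<close>

lemma bounded_correspondence_attained: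
  assumes cpt: "compact_space (mtopology_of X)" "compact_space (mtopology_of Y)"
    and ne: "mspace X \<noteq> {}"
    and ex: "\<And>c'. c < c' \<Longrightarrow> \<exists>R. bounded_correspondence c' X Y R"
  shows "\<exists>R. bounded_correspondence c X Y R"
proof -
  let ?P = "prod_topology (mtopology_of X) (mtopology_of Y)"
  define I where "I = mspace X <+> mspace Y"
  \<comment> \<open>The pairs lying over a point of either space; a choice from every
    \<open>S i\<close> thus has a range that projects onto both spaces.\<close>
  define S where "S = case_sum (\<lambda>x. {x} \<times> mspace Y) (\<lambda>y. mspace X \<times> {y})"
  define T where "T i = subtopology ?P (S i)" for i
  define Q where "Q = product_topology T I"
  define e where "e n = c + inverse (real (Suc n))" for n
  define F where "F h k = \<bar>mdist X (fst (h (fst k))) (fst (h (snd k)))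
    - mdist Y (snd (h (fst k))) (snd (h (snd k)))\<bar>" for h :: "'a + 'b \<Rightarrow> 'a \<times> 'b" and k
  \<comment> \<open>The choices of distortion at most \<open>e n\<close>, where \<open>e n\<close>
    decreases to \<open>c\<close>. These are nested nonempty closed sets in the compact space
    \<open>Q\<close>, so some \<open>h\<close> lies in all of them.\<close>
  define C where "C n = (\<Inter>k\<in>I \<times> I. {h \<in> topspace Q. F h k \<in> {..e n}})" for n
  have Ine: "I \<noteq> {}" using ne unfolding I_def by auto
  have SP: "S i \<subseteq> topspace ?P" if "i \<in> I" for i
    using that unfolding I_def S_def by auto
  have "compactin ?P (S i)" if "i \<in> I" for i
    using that cpt unfolding I_def S_def by (auto simp: compactin_Times compact_space_def)
  then have "compact_space (T i)" if "i \<in> I" for i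
    using that unfolding T_def by (simp add: compact_space_subtopology)
  then have "compact_space Q"
    unfolding Q_def by (simp add: compact_space_product_topology)
  moreover have "closedin Q (C n)" for n
  proof -
    have "closedin Q {h \<in> topspace Q. F h k \<in> {..e n}}" if k: "k \<in> I \<times> I" for k
    proof (rule closedin_continuous_map_preimage[where Y = euclideanreal])
      have "continuous_map Q ?P (\<lambda>h. h i)" if "i \<in> I" for i
        using continuous_map_into_fulltopology continuous_map_product_projection[OF that, of T]
        unfolding Q_def T_def by blast
      then have "continuous_map Q (mtopology_of X) (\<lambda>h. fst (h i))"
        "continuous_map Q (mtopology_of Y) (\<lambda>h. snd (h i))" if "i \<in> I" for i
        using that continuous_map_fst_of continuous_map_snd_of unfolding o_def by blast+
      then show "continuous_map Q euclideanreal (\<lambda>h. F h k)"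
        unfolding F_def using k by (intro continuous_intros) auto
    qed auto
    then show ?thesis unfolding C_def using Ine by (intro closedin_INT) auto
  qed
  moreover have "C n \<noteq> {}" for n
  proof -
    obtain R where R: "bounded_correspondence (e n) X Y R"
      using ex[of "e n"] unfolding e_def by auto
    note D = bounded_correspondenceD[OF R]
    have "\<exists>p. p \<in> R \<inter> S i" if i: "i \<in> I" for i
    proof (cases i)
      case (Inl x)
      then obtain p where "p \<in> R" "fst p = x" using i D(3) unfolding I_def by blast
      then show ?thesis using D(2) Inl unfolding S_def by (intro exI[of _ p]) (auto simp: mem_Times_iff)
    next
      case (Inr y)
      then obtain p where "p \<in> R" "snd p = y" using i D(4) unfolding I_def by blast
      then show ?thesis using D(1) Inr unfolding S_def by (intro exI[of _ p]) (auto simp: mem_Times_iff)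
    qed
    then obtain h where h: "\<And>i. i \<in> I \<Longrightarrow> h i \<in> R \<inter> S i" by metis
    \<comment> \<open>Points of the product topology are extensional functions, hence
      \<open>restrict\<close>.\<close>
    have "restrict h I \<in> C n"
      using h SP D(5) unfolding C_def F_def Q_def T_def by (auto simp: Ine)
    then show ?thesis by blast
  qed
  moreover have "decseq C"
  proof (rule decseq_SucI)
    fix n
    have "e (Suc n) \<le> e n" unfolding e_def by (simp add: field_simps)
    then show "C (Suc n) \<subseteq> C n" unfolding C_def by force
  qed
  ultimately have "(\<Inter>n. C n) \<noteq> {}" by (rule compact_space_imp_nest)
  then obtain h where h: "\<And>n. h \<in> C n" by blast
  have hS: "h i \<in> S i" if "i \<in> I" for i
    using h[of 0] that Ine unfolding C_def Q_def T_def by auto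
  have le: "F h k \<le> c" if "k \<in> I \<times> I" for k
  proof (rule LIMSEQ_le_const)
    show "e \<longlonglongrightarrow> c"
      unfolding e_def using tendsto_add[OF tendsto_const LIMSEQ_inverse_real_of_nat, of c] by simp
    show "\<exists>N. \<forall>n\<ge>N. F h k \<le> e n" using h that unfolding C_def by auto
  qed
  have "bounded_correspondence c X Y (h ` I)"
  proof (rule bounded_correspondenceI)
    fix p assume "p \<in> h ` I"
    then show "fst p \<in> mspace X \<and> snd p \<in> mspace Y" using hS SP by fastforce
  next
    fix x assume "x \<in> mspace X"
    then have "Inl x \<in> I" unfolding I_def by auto
    then show "\<exists>p\<in>h ` I. fst p = x"
      using hS[of "Inl x"] unfolding S_def by (intro bexI[of _ "h (Inl x)"]) auto
  next
    fix y assume "y \<in> mspace Y"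
    then have "Inr y \<in> I" unfolding I_def by auto
    then show "\<exists>p\<in>h ` I. snd p = y"
      using hS[of "Inr y"] unfolding S_def by (intro bexI[of _ "h (Inr y)"]) auto
  next
    fix p q assume "p \<in> h ` I" "q \<in> h ` I"
    then show "\<bar>mdist X (fst p) (fst q) - mdist Y (snd p) (snd q)\<bar> \<le> c"
      using le unfolding F_def by fastforce
  qed
  then show ?thesis ..
qed

text \<open>Reduces the metric axioms for \<open>GH_dist\<close> and the estimate along the geodesic
  to statements about correspondences. Attainment allows the non-strict inequality.\<close>

lemma GH_dist_le_iff:
  assumes "compact_space (mtopology_of X)" "compact_space (mtopology_of Y)"
    and "mspace X \<noteq> {}" "mspace Y \<noteq> {}"
  shows "GH_dist X Y \<le> r \<longleftrightarrow> (\<exists>R. bounded_correspondence (2 * r) X Y R)"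
proof
  assume le: "GH_dist X Y \<le> r"
  show "\<exists>R. bounded_correspondence (2 * r) X Y R"
  proof (rule bounded_correspondence_attained[OF assms(1-3)])
    fix c :: real assume "2 * r < c"
    then show "\<exists>R. bounded_correspondence c X Y R"
      using GH_dist_less_imp_correspondence[OF assms, of "c / 2"] le by simp
  qed
next
  assume "\<exists>R. bounded_correspondence (2 * r) X Y R"
  then show "GH_dist X Y \<le> r" using GH_dist_le[OF assms(1-3)] by blast
qed

text \<open>The distortion of a pair of points of \<open>R\<close> depends continuously on each of
  them, so the bound survives in the closure. A closed correspondence is compact when
  \<open>X\<close> and \<open>Y\<close> are, which makes its metric quotients compact.\<close>

lemma bounded_correspondence_closure_of:
  assumes "bounded_correspondence c X Y R"
  shows "bounded_correspondence c X Y (prod_topology (mtopology_of X) (mtopology_of Y) closure_of R)"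
proof -
  let ?P = "prod_topology (mtopology_of X) (mtopology_of Y)"
  note D = bounded_correspondenceD[OF assms]
  have RP: "R \<subseteq> topspace ?P" using D(1,2) by (auto simp: mem_Times_iff)
  then have sub: "R \<subseteq> ?P closure_of R" by (rule closure_of_subset)
  have carrier: "fst p \<in> mspace X" "snd p \<in> mspace Y" if "p \<in> ?P closure_of R" for p
    using that closure_of_subset_topspace[of ?P R] by (auto simp: mem_Times_iff)
  define F where "F p q = \<bar>mdist X (fst p) (fst q) - mdist Y (snd p) (snd q)\<bar>" for p q
  have F_commute: "F p q = F q p" for p q unfolding F_def by (simp add: mdist_commute)
  have clo: "closedin ?P {q \<in> topspace ?P. F p q \<in> {..c}}" if "p \<in> topspace ?P" for p
  proof (rule closedin_continuous_map_preimage[where Y = euclideanreal])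
    show "continuous_map ?P euclideanreal (F p)"
      unfolding F_def using that
      by (intro continuous_intros) (auto intro: continuous_map_fst continuous_map_snd)
  qed auto
  \<comment> \<open>The closure is taken in one variable at a time; \<open>two\<close> uses
    \<open>one\<close> with the variables swapped.\<close>
  have one: "F p q \<le> c" if p: "p \<in> R" and q: "q \<in> ?P closure_of R" for p q
  proof -
    have "?P closure_of R \<subseteq> {q \<in> topspace ?P. F p q \<in> {..c}}"
      using p RP D(5) by (intro closure_of_minimal clo) (auto simp: F_def)
    then show ?thesis using q by blast
  qed
  have two: "F p q \<le> c" if p: "p \<in> ?P closure_of R" and q: "q \<in> ?P closure_of R" for p q
  proof -
    have "?P closure_of R \<subseteq> {q \<in> topspace ?P. F p q \<in> {..c}}"
      using p RP one closure_of_subset_topspace[of ?P R] F_commute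
      by (intro closure_of_minimal clo) auto
    then show ?thesis using q by blast
  qed
  show ?thesis
    by (rule bounded_correspondenceI)
      (use sub carrier D(3,4) two in \<open>auto simp: F_def\<close>, (metis D(3,4) subsetD)+)
qed

subsection \<open>Interpolating compact ultrametrics\<close>

lemma compact_ultrametricD:
  assumes "compact_ultrametric X"
  shows "mspace X \<noteq> {}" "compact_space (mtopology_of X)"
    "x \<in> mspace X \<Longrightarrow> y \<in> mspace X \<Longrightarrow> z \<in> mspace X \<Longrightarrow>
      mdist X x z \<le> max (mdist X x y) (mdist X y z)"
  using assms unfolding compact_ultrametric_def by blast+

lemma compact_space_Lipschitz_image:
  assumes "Lipschitz_continuous_map X Y f" "f ` mspace X = mspace Y"
    and "compact_space (mtopology_of X)"
  shows "compact_space (mtopology_of Y)"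
  using image_compactin[OF _ Lipschitz_continuous_imp_continuous_map[OF assms(1)], of "mspace X"]
    assms(2,3) by (simp add: compact_space_def)

lemma compact_ultrametric_isometric:
  assumes X: "compact_ultrametric X" and iso: "isometric X Y"
  shows "compact_ultrametric Y"
proof -
  obtain f where f: "isometric_embedding f X Y" "f ` mspace X = mspace Y"
    using iso unfolding isometric_def by blast
  have d: "mdist Y (f x) (f x') = mdist X x x'" if "x \<in> mspace X" "x' \<in> mspace X" for x x'
    using f that unfolding isometric_embedding_def by blast
  have "Lipschitz_continuous_map X Y f"
    unfolding Lipschitz_continuous_map_def using f d by (auto intro!: exI[of _ 1])
  then have "compact_space (mtopology_of Y)"
    using compact_space_Lipschitz_image f(2) compact_ultrametricD(2)[OF X] by blast
  moreover have "mspace Y \<noteq> {}" using f(2) compact_ultrametricD(1)[OF X] by blast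
  ultimately show ?thesis
    unfolding compact_ultrametric_def f(2)[symmetric]
    using d compact_ultrametricD(3)[OF X] by auto
qed

section \<open>Metric quotients of pseudo-ultrametrics\<close>

text \<open>Each class of points at \<open>w\<close>-distance \<open>0\<close> is represented by one
  of its members, so the quotient stays in the type \<open>'a\<close>. By \<open>Lip\<close> the
  quotient map is continuous on the compact set \<open>R\<close>, so its image is compact.
  \<open>nonneg\<close> and \<open>commute\<close> range over all points because
  \<open>Metric_space\<close> constrains distances outside the carrier too.\<close>

lemma pseudo_ultrametric_quotient:
  fixes w :: "'a \<Rightarrow> 'a \<Rightarrow> real"
  assumes nonneg: "\<And>p q. 0 \<le> w p q" and commute: "\<And>p q. w p q = w q p"
    and refl: "\<And>p. p \<in> R \<Longrightarrow> w p p = 0"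
    and ultra: "\<And>p q r. p \<in> R \<Longrightarrow> q \<in> R \<Longrightarrow> r \<in> R \<Longrightarrow> w p r \<le> max (w p q) (w q r)"
    and Lip: "\<And>p q. p \<in> R \<Longrightarrow> q \<in> R \<Longrightarrow> w p q \<le> mdist M p q"
    and R: "compactin (mtopology_of M) R" "R \<noteq> {}"
  shows "\<exists>(W :: 'a metric) k. compact_ultrametric W \<and> mspace W = k ` R \<and>
    (\<forall>p\<in>R. \<forall>q\<in>R. mdist W (k p) (k q) = w p q)"
proof -
  define k where "k p = (SOME q. q \<in> R \<and> w p q = 0)" for p
  have k: "k p \<in> R" "w p (k p) = 0" if "p \<in> R" for p
    using someI[of "\<lambda>q. q \<in> R \<and> w p q = 0", OF conjI[OF that refl[OF that]]] unfolding k_def by auto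
  \<comment> \<open>Used in both directions, this makes \<open>w\<close> well defined on
    classes.\<close>
  have w_le: "w p' q' \<le> w p q" if "p \<in> R" "p' \<in> R" "q \<in> R" "q' \<in> R" "w p p' = 0" "w q q' = 0"
    for p p' q q'
    using ultra[of p' p q'] ultra[of p q q'] that commute[of p p'] nonneg[of p q] by auto
  have wk: "w (k p) (k q) = w p q" if "p \<in> R" "q \<in> R" for p q
    using w_le[of p "k p" q "k q"] w_le[of "k p" p "k q" q] k[OF that(1)] k[OF that(2)] that
      commute[of p "k p"] commute[of q "k q"] by simp
  have k_eq: "k p = k q" if "p \<in> R" "q \<in> R" "w p q = 0" for p q
  proof -
    \<comment> \<open>Both choices are made from the same predicate, so \<open>SOME\<close> returns
      the same representative.\<close>
    have "(r \<in> R \<and> w p r = 0) = (r \<in> R \<and> w q r = 0)" for r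
      using w_le[of p q r r] w_le[of q p r r] that commute[of p q] nonneg[of p r] nonneg[of q r] refl[of r]
      by auto
    then show ?thesis unfolding k_def by presburger
  qed
  interpret Metric_space "k ` R" w
  proof
    fix x y assume "x \<in> k ` R" "y \<in> k ` R"
    then obtain p q where "x = k p" "y = k q" "p \<in> R" "q \<in> R" by blast
    then show "w x y = 0 \<longleftrightarrow> x = y" using wk[of p q] k_eq[of p q] refl[of x] k(1)[of p] by auto
  next
    fix x y z assume "x \<in> k ` R" "y \<in> k ` R" "z \<in> k ` R"
    then have "w x z \<le> max (w x y) (w y z)" using k(1) by (blast intro: ultra)
    then show "w x z \<le> w x y + w y z" using nonneg[of x y] nonneg[of y z] by linarith
  qed (use nonneg commute in auto)
  define W where "W = metric (k ` R, w)"
  have W: "mspace W = k ` R" "mdist W = w" unfolding W_def by auto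
  have RM: "R \<subseteq> mspace M" using compactin_subset_topspace[OF R(1)] by simp
  have MR: "mspace (submetric M R) = R" using RM by auto
  have "Lipschitz_continuous_map (submetric M R) W k"
    unfolding Lipschitz_continuous_map_def W MR mdist_submetric
    by (intro conjI exI[of _ 1] ballI) (simp_all add: wk Lip)
  moreover have "compact_space (mtopology_of (submetric M R))"
    using R(1) by (simp add: mtopology_of_submetric compact_space_subtopology)
  ultimately have "compact_space (mtopology_of W)"
    by (intro compact_space_Lipschitz_image[of "submetric M R" W k]) (simp_all only: W MR)
  moreover have "k ` R \<subseteq> R" using k(1) by blast
  ultimately have "compact_ultrametric W"
    unfolding compact_ultrametric_def W using R(2) by (intro conjI ballI ultra) auto
  then show ?thesis using W wk by (intro exI[of _ W] exI[of _ k]) simp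
qed

text \<open>A tropical segment: decreasing an ultrametric by a constant (truncated at \<open>0\<close>) and taking
  the maximum of two ultrametrics both preserve the ultrametric inequality, which linear
  interpolation does not.\<close>

definition interpolation ::
  "real \<Rightarrow> 'a metric \<Rightarrow> 'b metric \<Rightarrow> real \<Rightarrow> 'a \<times> 'b \<Rightarrow> 'a \<times> 'b \<Rightarrow> real" where
  "interpolation c X Y t p q =
     max 0 (max (mdist X (fst p) (fst q) - t * c) (mdist Y (snd p) (snd q) - (1 - t) * c))"

text \<open>Changing \<open>t\<close> moves the two offsets by the same amount in opposite
  directions, and a maximum moves no more than its arguments.\<close>

lemma interpolation_Lipschitz:
  assumes "0 \<le> c"
  shows "\<bar>interpolation c X Y s p q - interpolation c X Y t p q\<bar> \<le> \<bar>s - t\<bar> * c"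
proof -
  \<comment> \<open>Here \<open>u\<close> and \<open>v\<close> stand for \<open>s * c\<close> and
    \<open>t * c\<close>, in either order.\<close>
  have le: "max 0 (max (a - u) (b - (c - u))) \<le> max 0 (max (a - v) (b - (c - v))) + \<bar>u - v\<bar>"
    for a b u v :: real
    by (intro max.boundedI; linarith)
  have st: "\<bar>s * c - t * c\<bar> = \<bar>s - t\<bar> * c" "\<bar>t * c - s * c\<bar> = \<bar>s - t\<bar> * c"
    using assms by (simp_all add: left_diff_distrib[symmetric] abs_mult abs_minus_commute)
  show ?thesis
    unfolding interpolation_def left_diff_distrib mult_1_left
    using le[of "mdist X (fst p) (fst q)" "s * c" "mdist Y (snd p) (snd q)" "t * c"]
      le[of "mdist X (fst p) (fst q)" "t * c" "mdist Y (snd p) (snd q)" "s * c"]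
    unfolding st by (intro abs_leI) (simp_all only: diff_le_eq add.commute minus_diff_eq left_diff_distrib[symmetric])
qed

text \<open>For \<open>t\<close> in the unit interval both offsets are nonnegative, so the
  interpolation vanishes on the diagonal and is dominated by the product metric, the
  \<open>M\<close> of the quotient lemma.\<close>

lemma interpolation_quotient:
  fixes X :: "'a metric" and Y :: "'b metric"
  assumes X: "compact_ultrametric X" and Y: "compact_ultrametric Y" and c: "0 \<le> c"
    and R: "compactin (prod_topology (mtopology_of X) (mtopology_of Y)) R" "R \<noteq> {}"
    and t: "t \<in> {0..1}"
  shows "\<exists>(W :: ('a \<times> 'b) metric) k. compact_ultrametric W \<and> mspace W = k ` R \<and>
    (\<forall>p\<in>R. \<forall>q\<in>R. mdist W (k p) (k q) = interpolation c X Y t p q)"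
proof (rule pseudo_ultrametric_quotient[where M = "prod_metric X Y"])
  have tc: "0 \<le> t * c" "0 \<le> (1 - t) * c" using t c by auto
  have RXY: "R \<subseteq> mspace X \<times> mspace Y" using compactin_subset_topspace[OF R(1)] by simp
  show "0 \<le> interpolation c X Y t p q" for p q unfolding interpolation_def by simp
  show "interpolation c X Y t p q = interpolation c X Y t q p" for p q
    unfolding interpolation_def by (simp add: mdist_commute)
  show "interpolation c X Y t p p = 0" if "p \<in> R" for p
    using RXY that tc unfolding interpolation_def by auto
  show "interpolation c X Y t p r \<le> max (interpolation c X Y t p q) (interpolation c X Y t q r)"
    if "p \<in> R" "q \<in> R" "r \<in> R" for p q r
  proof -
    have "mdist X (fst p) (fst r) \<le> max (mdist X (fst p) (fst q)) (mdist X (fst q) (fst r))"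
      by (rule compact_ultrametricD(3)[OF X]) (use RXY that in auto)
    moreover have "mdist Y (snd p) (snd r) \<le> max (mdist Y (snd p) (snd q)) (mdist Y (snd q) (snd r))"
      by (rule compact_ultrametricD(3)[OF Y]) (use RXY that in auto)
    ultimately show ?thesis
      unfolding interpolation_def by (intro max.boundedI) (auto simp: le_max_iff_disj)
  qed
  show "interpolation c X Y t p q \<le> mdist (prod_metric X Y) p q" for p q
  proof -
    have "mdist X (fst p) (fst q) \<le> mdist (prod_metric X Y) p q"
      "mdist Y (snd p) (snd q) \<le> mdist (prod_metric X Y) p q"
      by (simp_all add: prod_dist_def split_beta)
    then show ?thesis
      using tc mdist_nonneg[of "prod_metric X Y" p q] unfolding interpolation_def
      by (auto simp del: mdist_prod_metric)
  qed
  show "compactin (mtopology_of (prod_metric X Y)) R" using R(1) by simp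
qed (rule R(2))

section \<open>Metric properties of \<open>GH_dist\<close> on compact ultrametric spaces\<close>

lemma GH_dist_le_iff_ultrametric:
  assumes "compact_ultrametric X" "compact_ultrametric Y"
  shows "GH_dist X Y \<le> r \<longleftrightarrow> (\<exists>R. bounded_correspondence (2 * r) X Y R)"
  using assms by (simp add: GH_dist_le_iff compact_ultrametricD)

lemma GH_dist_attained:
  assumes "compact_ultrametric X" "compact_ultrametric Y"
  obtains R where "bounded_correspondence (2 * GH_dist X Y) X Y R"
  using GH_dist_le_iff_ultrametric[OF assms, of "GH_dist X Y"] by auto

lemma GH_dist_nonneg:
  assumes "compact_ultrametric X" "compact_ultrametric Y"
  shows "0 \<le> GH_dist X Y"
proof -
  obtain R where "bounded_correspondence (2 * GH_dist X Y) X Y R"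
    using GH_dist_attained[OF assms] .
  then show ?thesis
    using bounded_correspondence_nonneg compact_ultrametricD(1)[OF assms(1)] by fastforce
qed

lemma GH_dist_commute:
  assumes "compact_ultrametric X" "compact_ultrametric Y"
  shows "GH_dist X Y = GH_dist Y X"
proof (rule antisym)
  show "GH_dist X Y \<le> GH_dist Y X"
    using GH_dist_attained[OF assms(2,1)] GH_dist_le_iff_ultrametric[OF assms]
      bounded_correspondence_converse by metis
  show "GH_dist Y X \<le> GH_dist X Y"
    using GH_dist_attained[OF assms] GH_dist_le_iff_ultrametric[OF assms(2,1)]
      bounded_correspondence_converse by metis
qed

lemma GH_dist_triangle:
  assumes "compact_ultrametric X" "compact_ultrametric Y" "compact_ultrametric Z"
  shows "GH_dist X Z \<le> GH_dist X Y + GH_dist Y Z"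
proof -
  obtain R S where "bounded_correspondence (2 * GH_dist X Y) X Y R"
    "bounded_correspondence (2 * GH_dist Y Z) Y Z S"
    using GH_dist_attained assms by metis
  then have "bounded_correspondence (2 * (GH_dist X Y + GH_dist Y Z)) X Z (R O S)"
    using bounded_correspondence_relcomp by (metis distrib_left)
  then show ?thesis using GH_dist_le_iff_ultrametric assms by blast
qed

text \<open>Attainment is the point: distance \<open>0\<close> yields a correspondence of distortion
  exactly \<open>0\<close>, and that is the graph of an isometry.\<close>

lemma GH_dist_eq_0_iff:
  assumes "compact_ultrametric X" "compact_ultrametric Y"
  shows "GH_dist X Y = 0 \<longleftrightarrow> isometric X Y"
proof -
  have "GH_dist X Y = 0 \<longleftrightarrow> GH_dist X Y \<le> 0" using GH_dist_nonneg[OF assms] by auto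
  also have "\<dots> \<longleftrightarrow> (\<exists>R. bounded_correspondence 0 X Y R)"
    by (simp add: GH_dist_le_iff_ultrametric[OF assms])
  also have "\<dots> \<longleftrightarrow> isometric X Y"
    using isometric_imp_bounded_correspondence bounded_correspondence_0_imp_isometric by blast
  finally show ?thesis .
qed

text \<open>Unlike in \<open>GH_dist_cong\<close>, isometric spaces may have different point types
  here, as needed to compare quotients over \<open>'a \<times> 'b\<close> with \<open>X\<close> and
  \<open>Y\<close>. The triangle inequality works across types.\<close>

lemma GH_dist_isometric_cong:
  assumes X: "compact_ultrametric X" "isometric X X'" and Y: "compact_ultrametric Y" "isometric Y Y'"
  shows "GH_dist X Y = GH_dist X' Y'"
proof -
  have X': "compact_ultrametric X'" and Y': "compact_ultrametric Y'"
    using compact_ultrametric_isometric X Y by blast+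
  have "GH_dist X X' = 0" "GH_dist X' X = 0" "GH_dist Y Y' = 0" "GH_dist Y' Y = 0"
    using GH_dist_eq_0_iff X Y X' Y' isometric_sym by blast+
  then show ?thesis
    using GH_dist_triangle[OF X(1) X' Y(1)] GH_dist_triangle[OF X' Y' Y(1)]
      GH_dist_triangle[OF X' X(1) Y'] GH_dist_triangle[OF X(1) Y(1) Y'] by linarith
qed

section \<open>The geodesic as a family of spaces\<close>

lemma ultrametric_geodesic_family:
  fixes X :: "'a metric" and Y :: "'b metric"
  assumes X: "compact_ultrametric X" and Y: "compact_ultrametric Y"
  shows "\<exists>W :: real \<Rightarrow> ('a \<times> 'b) metric. (\<forall>t\<in>{0..1}. compact_ultrametric (W t)) \<and>
    isometric (W 0) X \<and> isometric (W 1) Y \<and>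
    (\<forall>s\<in>{0..1}. \<forall>t\<in>{0..1}. GH_dist (W s) (W t) = \<bar>s - t\<bar> * GH_dist X Y)"
proof -
  let ?P = "prod_topology (mtopology_of X) (mtopology_of Y)"
  define c where "c = 2 * GH_dist X Y"
  have c: "0 \<le> c" unfolding c_def using GH_dist_nonneg[OF X Y] by simp
  obtain R0 where "bounded_correspondence c X Y R0"
    using GH_dist_attained[OF X Y] unfolding c_def by blast
  define R where "R = ?P closure_of R0"
  have R: "bounded_correspondence c X Y R"
    unfolding R_def by (rule bounded_correspondence_closure_of) fact
  note D = bounded_correspondenceD[OF R]
  have cptR: "compactin ?P R"
    using X Y unfolding R_def
    by (intro closedin_compact_space) (auto simp: compact_space_prod_topology compact_ultrametricD)
  have Rne: "R \<noteq> {}" using D(3) compact_ultrametricD(1)[OF X] by blast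
  \<comment> \<open>The condition on \<open>t\<close> sits under the existential so that choice
    gives functions \<open>W\<close> and \<open>k\<close> defined for every real
    \<open>t\<close>.\<close>
  have "\<forall>t. \<exists>(W :: ('a \<times> 'b) metric) k. t \<in> {0..1} \<longrightarrow> compact_ultrametric W \<and> mspace W = k ` R \<and>
      (\<forall>p\<in>R. \<forall>q\<in>R. mdist W (k p) (k q) = interpolation c X Y t p q)"
    using interpolation_quotient[OF X Y c cptR Rne] by blast
  then obtain W :: "real \<Rightarrow> ('a \<times> 'b) metric" and k
    where Wk: "\<And>t. t \<in> {0..1} \<longrightarrow> compact_ultrametric (W t) \<and> mspace (W t) = k t ` R \<and>
      (\<forall>p\<in>R. \<forall>q\<in>R. mdist (W t) (k t p) (k t q) = interpolation c X Y t p q)"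
    by metis
  have Wcu: "compact_ultrametric (W t)" and W: "mspace (W t) = k t ` R"
    "\<And>p q. p \<in> R \<Longrightarrow> q \<in> R \<Longrightarrow> mdist (W t) (k t p) (k t q) = interpolation c X Y t p q"
    if "t \<in> {0..1}" for t
    using Wk[of t] that by auto
  \<comment> \<open>On \<open>R\<close> the distance in \<open>Y\<close> exceeds that in
    \<open>X\<close> by at most \<open>c\<close>, so at \<open>t = 0\<close> the first term attains
    the maximum and the first projection induces the isometry.\<close>
  have iso0: "isometric (W 0) X"
  proof (rule bounded_correspondence_0_imp_isometric)
    have "interpolation c X Y 0 p q = mdist X (fst p) (fst q)" if "p \<in> R" "q \<in> R" for p q
      using D(5)[OF that] mdist_nonneg[of X "fst p" "fst q"] unfolding interpolation_def by auto
    then show "bounded_correspondence 0 (W 0) X ((\<lambda>p. (k 0 p, fst p)) ` R)"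
      using R unfolding bounded_correspondence_def by (auto simp: W image_image)
  qed
  have iso1: "isometric (W 1) Y"
  proof (rule bounded_correspondence_0_imp_isometric)
    have "interpolation c X Y 1 p q = mdist Y (snd p) (snd q)" if "p \<in> R" "q \<in> R" for p q
      using D(5)[OF that] mdist_nonneg[of Y "snd p" "snd q"] unfolding interpolation_def by auto
    then show "bounded_correspondence 0 (W 1) Y ((\<lambda>p. (k 1 p, snd p)) ` R)"
      using R unfolding bounded_correspondence_def by (auto simp: W image_image)
  qed
  have le: "GH_dist (W s) (W t) \<le> \<bar>s - t\<bar> * GH_dist X Y" if "s \<in> {0..1}" "t \<in> {0..1}" for s t
  proof -
    \<comment> \<open>The two classes of the same point of \<open>R\<close> are matched.\<close>
    have "bounded_correspondence (2 * (\<bar>s - t\<bar> * GH_dist X Y)) (W s) (W t) ((\<lambda>p. (k s p, k t p)) ` R)"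
      using interpolation_Lipschitz[OF c, of X Y s _ _ t] that unfolding bounded_correspondence_def
      by (auto simp: W image_image c_def ac_simps)
    then show ?thesis using GH_dist_le_iff_ultrametric Wcu that by blast
  qed
  have ends: "GH_dist (W 0) (W 1) = GH_dist X Y"
    by (rule GH_dist_isometric_cong[OF Wcu iso0 Wcu iso1]) auto
  have eq: "GH_dist (W s) (W t) = \<bar>s - t\<bar> * GH_dist X Y"
    if st: "s \<in> {0..1}" "t \<in> {0..1}" "s \<le> t" for s t
  proof -
    \<comment> \<open>The upper bounds on the outer two pieces leave at least \<open>t - s\<close>
      times the full distance for the middle one.\<close>
    have "GH_dist (W 0) (W 1) \<le> GH_dist (W 0) (W s) + GH_dist (W s) (W t) + GH_dist (W t) (W 1)"
      using GH_dist_triangle[OF Wcu Wcu Wcu, of 0 s 1] GH_dist_triangle[OF Wcu Wcu Wcu, of s t 1] st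
      by simp
    then have "GH_dist X Y \<le> s * GH_dist X Y + GH_dist (W s) (W t) + (1 - t) * GH_dist X Y"
      using le[of 0 s] le[of t 1] st ends by simp
    then have "(t - s) * GH_dist X Y \<le> GH_dist (W s) (W t)" by (simp add: algebra_simps)
    then show ?thesis using le[OF st(1,2)] st(3) by simp
  qed
  have "GH_dist (W s) (W t) = \<bar>s - t\<bar> * GH_dist X Y" if st: "s \<in> {0..1}" "t \<in> {0..1}" for s t
  proof (cases "s \<le> t")
    case False
    then show ?thesis
      using eq[OF st(2,1)] GH_dist_commute[OF Wcu[OF st(1)] Wcu[OF st(2)]]
      by (simp add: abs_minus_commute)
  qed (use eq[OF st] in simp)
  then show ?thesis using Wcu iso0 iso1 by (intro exI[of _ W]) simp
qed

subsection \<open>Isometry classes\<close>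

text \<open>A point is determined by the balls around countably many net points that contain it,
  hence by a set of natural numbers, and such sets inject into the reals.\<close>

lemma compact_metric_inj_real:
  assumes "compact_space (mtopology_of X)"
  obtains \<phi> :: "'a \<Rightarrow> real" where "inj_on \<phi> (mspace (X :: 'a metric))"
proof -
  interpret Metric_space "mspace X" "mdist X" by (rule Metric_space_mspace_mdist)
  have "mtotally_bounded (mspace X)"
    using assms compactin_imp_mtotally_bounded unfolding compact_space_def mtopology_of_def by simp
  then have "\<forall>n. \<exists>K. finite K \<and> K \<subseteq> mspace X \<and> mspace X \<subseteq> (\<Union>x\<in>K. mball x (inverse (real (Suc n))))"
    unfolding mtotally_bounded_def by (meson inverse_positive_iff_positive of_nat_0_less_iff zero_less_Suc)
  then obtain K where K: "\<And>n. finite (K n)" "\<And>n. K n \<subseteq> mspace X"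
    "\<And>n. mspace X \<subseteq> (\<Union>x\<in>K n. mball x (inverse (real (Suc n))))" by metis
  define U where "U = Sigma UNIV K"
  have "countable U" unfolding U_def using K(1) by (intro countable_SIGMA) (auto intro: countable_finite)
  define A where "A x = to_nat_on U ` {(n, d) \<in> U. mdist X d x < inverse (real (Suc n))}" for x
  have "inj_on A (mspace X)"
  proof (rule inj_onI, rule ccontr)
    fix x y assume xy: "x \<in> mspace X" "y \<in> mspace X" "A x = A y" "x \<noteq> y"
    then have "0 < mdist X x y / 2" by simp
    \<comment> \<open>A ball of radius below half the distance cannot contain both points.\<close>
    then obtain n where n: "inverse (real (Suc n)) < mdist X x y / 2" using reals_Archimedean by blast
    obtain d where d: "d \<in> K n" "mdist X d x < inverse (real (Suc n))" using K(3)[of n] xy(1) by auto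
    have "inj_on (to_nat_on U) U" by (rule inj_on_to_nat_on) fact
    moreover have "{(n, d) \<in> U. mdist X d x < inverse (real (Suc n))} \<subseteq> U" for x by auto
    ultimately have "{(n, d) \<in> U. mdist X d x < inverse (real (Suc n))}
        = {(n, d) \<in> U. mdist X d y < inverse (real (Suc n))}"
      using xy(3) unfolding A_def by (simp only: inj_on_image_eq_iff)
    moreover have "(n, d) \<in> {(n, d) \<in> U. mdist X d x < inverse (real (Suc n))}"
      using d unfolding U_def by auto
    ultimately have "mdist X d y < inverse (real (Suc n))" by auto
    then show False
      using n d triangle[of x d y] xy K(2)[of n] commute[of x d] by auto
  qed
  moreover obtain g :: "nat set \<Rightarrow> real" where "inj g"
    using nat_sets_eqpoll_reals unfolding eqpoll_def bij_betw_def by auto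
  ultimately have "inj_on (g \<circ> A) (mspace X)"
    by (intro comp_inj_on) (auto intro: inj_on_subset)
  then show ?thesis using that by blast
qed

lemma isometric_inj_transport:
  assumes "inj_on \<phi> (mspace X)"
  shows "\<exists>X'. isometric X X' \<and> mspace X' = \<phi> ` mspace X"
proof -
  let ?\<psi> = "inv_into (mspace X) \<phi>"
  interpret Metric_space "\<phi> ` mspace X" "\<lambda>u v. mdist X (?\<psi> u) (?\<psi> v)"
    by standard (use assms in \<open>auto simp: mdist_commute intro: mdist_triangle\<close>)
  have "isometric_embedding \<phi> X (metric (\<phi> ` mspace X, \<lambda>u v. mdist X (?\<psi> u) (?\<psi> v)))"
    unfolding isometric_embedding_def using assms by auto
  then show ?thesis unfolding isometric_def by force
qed

lemma real_representative:
  assumes "compact_ultrametric X"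
  obtains X' :: "real metric" where "compact_ultrametric X'" "isometric X X'"
  using assms compact_metric_inj_real[OF compact_ultrametricD(2)] isometric_inj_transport
    compact_ultrametric_isometric by metis

lemma iso_class_cong: "isometric X Y \<Longrightarrow> iso_class X = iso_class Y"
  unfolding iso_class_def by (intro Collect_cong) (metis isometric_sym isometric_trans)

text \<open>\<open>ultra_classes\<close> is built from spaces of reals; a real representative brings
  in spaces over any type, such as the quotients \<open>W t\<close>.\<close>

lemma iso_class_in_ultra_classes:
  assumes "compact_ultrametric X"
  shows "iso_class X \<in> ultra_classes"
proof -
  obtain X' :: "real metric" where X': "compact_ultrametric X'" "isometric X X'"
    using real_representative[OF assms] .
  show ?thesis
    unfolding ultra_classes_def iso_class_cong[OF X'(2)] using X'(1) by blast
qed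

lemma GH_class_dist_eq_GH_dist:
  assumes "compact_ultrametric X" "compact_ultrametric Y"
  shows "GH_class_dist (iso_class X) (iso_class Y) = GH_dist X Y"
proof -
  obtain X' :: "real metric" where X': "compact_ultrametric X'" "isometric X X'"
    using real_representative[OF assms(1)] .
  obtain Y' :: "real metric" where Y': "compact_ultrametric Y'" "isometric Y Y'"
    using real_representative[OF assms(2)] .
  show ?thesis
    unfolding iso_class_cong[OF X'(2)] iso_class_cong[OF Y'(2)]
    using GH_class_dist_iso_class[OF X'(1) Y'(1)]
      GH_dist_isometric_cong[OF assms(1) X'(2) assms(2) Y'(2)] by simp
qed

lemma Metric_space_ultra_classes: "Metric_space ultra_classes GH_class_dist"
proof
  fix A B
  show "0 \<le> GH_class_dist A B"
  \<comment> \<open>Nonnegativity and symmetry are also required outside the carrier, where the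
    default value \<open>0\<close> settles them.\<close>
  proof (cases "A \<in> ultra_classes \<and> B \<in> ultra_classes")
    case True
    then show ?thesis unfolding ultra_classes_def by (auto simp: GH_class_dist_eq_GH_dist GH_dist_nonneg)
  qed (auto simp: GH_class_dist_def)
  show "GH_class_dist A B = GH_class_dist B A"
  proof (cases "A \<in> ultra_classes \<and> B \<in> ultra_classes")
    case True
    then show ?thesis
      unfolding ultra_classes_def by (auto simp: GH_class_dist_eq_GH_dist intro: GH_dist_commute)
  qed (auto simp: GH_class_dist_def)
  show "GH_class_dist A B = 0 \<longleftrightarrow> A = B" if AB: "A \<in> ultra_classes" "B \<in> ultra_classes"
  proof -
    obtain X Y :: "real metric" where XY: "compact_ultrametric X" "A = iso_class X"
      "compact_ultrametric Y" "B = iso_class Y"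
      using AB unfolding ultra_classes_def by blast
    have "A = B \<longleftrightarrow> isometric X Y"
      using iso_class_cong isometric_refl[of Y] unfolding XY iso_class_def by blast
    then show ?thesis using XY by (simp add: GH_class_dist_eq_GH_dist GH_dist_eq_0_iff)
  qed
next
  fix A B C assume "A \<in> ultra_classes" "B \<in> ultra_classes" "C \<in> ultra_classes"
  then show "GH_class_dist A C \<le> GH_class_dist A B + GH_class_dist B C"
    unfolding ultra_classes_def by (auto simp: GH_class_dist_eq_GH_dist GH_dist_triangle)
qed

lemma ultra_classes_geodesic:
  fixes X :: "'a metric" and Y :: "'b metric"
  assumes X: "compact_ultrametric X" and Y: "compact_ultrametric Y"
  shows "\<exists>\<gamma>. \<gamma> \<in> {0..1} \<rightarrow> ultra_classes \<and> \<gamma> 0 = iso_class X \<and> \<gamma> 1 = iso_class Y \<and>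
    (\<forall>s\<in>{0..1::real}. \<forall>t\<in>{0..1}. GH_class_dist (\<gamma> s) (\<gamma> t) = \<bar>s - t\<bar> * GH_dist X Y)"
proof -
  obtain W :: "real \<Rightarrow> ('a \<times> 'b) metric"
    where "\<forall>t\<in>{0..1}. compact_ultrametric (W t)" "isometric (W 0) X" "isometric (W 1) Y"
      "\<forall>s\<in>{0..1}. \<forall>t\<in>{0..1}. GH_dist (W s) (W t) = \<bar>s - t\<bar> * GH_dist X Y"
    using ultrametric_geodesic_family[OF X Y] by (elim exE conjE)
  then show ?thesis
    \<comment> \<open>Passing to classes turns the isometries at the endpoints into
      equalities.\<close>
    by (intro exI[of _ "\<lambda>t. iso_class (W t)"])
      (simp add: iso_class_in_ultra_classes iso_class_cong GH_class_dist_eq_GH_dist)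
qed

text \<open>The second conjunct admits arbitrary point types and measures with
  \<open>GH_dist\<close> of the given spaces, so encoding classes by real representatives loses no
  generality.\<close>

theorem theorem7p33:
  fixes X :: "'a metric" and Y :: "'b metric"
  shows "geodesic_metric_space ultra_classes GH_class_dist \<and>
    (compact_ultrametric X \<longrightarrow> compact_ultrametric Y \<longrightarrow>
      (\<exists>\<gamma>. \<gamma> \<in> {0..1} \<rightarrow> ultra_classes \<and> \<gamma> 0 = iso_class X \<and> \<gamma> 1 = iso_class Y \<and>
        (\<forall>s\<in>{0..1::real}. \<forall>t\<in>{0..1}.
           GH_class_dist (\<gamma> s) (\<gamma> t) = \<bar>s - t\<bar> * GH_dist X Y)))"
proof (intro conjI impI)
  have "\<exists>\<gamma>. geodesic_between ultra_classes GH_class_dist A B \<gamma>"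
    if AB: "A \<in> ultra_classes" "B \<in> ultra_classes" for A B
  proof -
    obtain X' Y' :: "real metric" where XY: "compact_ultrametric X'" "A = iso_class X'"
      "compact_ultrametric Y'" "B = iso_class Y'"
      using AB unfolding ultra_classes_def by blast
    then show ?thesis
      using ultra_classes_geodesic[OF XY(1,3)]
      unfolding geodesic_between_def by (simp add: GH_class_dist_eq_GH_dist)
  qed
  then show "geodesic_metric_space ultra_classes GH_class_dist"
    unfolding geodesic_metric_space_def using Metric_space_ultra_classes by blast
qed (rule ultra_classes_geodesic)

end
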